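(* Let $f\in\mathcal{C}_{\mathcal{B}}$. Then $|H_3(1)|\leq \frac{1}{576}$. This result is sharp, that is, there exists $f\in\mathcal{C}_{\mathcal{B}}$ for which equality holds.
   Context: Let $\mathbb{D}=\{z\in\mathbb{C}:|z|<1\}$. Let $\mathcal{A}$ be the class of analytic functions $f$ on $\mathbb{D}$ of the form $f(z)=z+\sum_{n=2}^{\infty}a_nz^n$. For analytic functions $h,g$ on $\mathbb{D}$, $h\prec g$ ($h$ is subordinate to $g$) means that there is an analytic function $w$ on $\mathbb{D}$ with $w(0)=0$ and $|w(z)|\le |z|$ (a Schwarz function) such that $h(z)=g(w(z))$ for $z \in \mathbb{D}$. The class $\mathcal{C}_{\mathcal{B}}$ is $$\mathcal{C}_{\mathcal{B}}=\left\{f\in\mathcal{A}:\ 1+\frac{zf''(z)}{f'(z)}\prec\sqrt{1+\tanh z}\right\},$$ where the branch of the square root is the one with value $1$ at $z=0$. For $f(z)=z+\sum_{n=2}^{\infty}a_nz^n\in\mathcal{A}$ with $a_1:=1$, the Hankel determinant $H_q(n)$ ($q,n\in\mathbb{N}$) is the determinant of the $q\times q$ matrix whose $(i,j)$ entry is $a_{n+i+j-2}$, $1\le i,j\le q$. In particular, $H_3(1)=2a_2a_3a_4-a_3^3-a_4^2-a_2^2a_5+a_3a_5$. *)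

theory Defs
  imports
    "HOL-Complex_Analysis.Complex_Analysis"
    "Jordan_Normal_Form.Determinant"
begin

abbreviation unit_disk :: "complex set" where
  "unit_disk \<equiv> ball 0 1"

text \<open>Functions on the unit disk are total functions on \<^typ>\<open>complex\<close>; all notions below depend
  only on their values in the disk.\<close>

definition class_A :: "(complex \<Rightarrow> complex) set" where
  "class_A = {f. f holomorphic_on unit_disk \<and>
     (\<exists>a. \<forall>z\<in>unit_disk. (\<lambda>n. a (n + 2) * z ^ (n + 2)) sums (f z - z))}"

definition taylor_coeff :: "(complex \<Rightarrow> complex) \<Rightarrow> nat \<Rightarrow> complex" where
  "taylor_coeff f n = fps_nth (fps_expansion f 0) n"

definition schwarz_function :: "(complex \<Rightarrow> complex) \<Rightarrow> bool" where
  "schwarz_function w \<longleftrightarrow>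
     w holomorphic_on unit_disk \<and> w 0 = 0 \<and> (\<forall>z\<in>unit_disk. norm (w z) \<le> norm z)"

definition subordinate :: "(complex \<Rightarrow> complex) \<Rightarrow> (complex \<Rightarrow> complex) \<Rightarrow> bool"
    (infix "\<prec>\<^sub>s" 50) where
  "h \<prec>\<^sub>s g \<longleftrightarrow> h holomorphic_on unit_disk \<and> g holomorphic_on unit_disk \<and>
     (\<exists>w. schwarz_function w \<and> (\<forall>z\<in>unit_disk. h z = g (w z)))"

text \<open>Subordination requires \<open>1 + z f''(z) / f'(z)\<close> to be holomorphic on the disk. Hence
  \<open>f'\<close> has no zero there, and the convention \<open>x / 0 = 0\<close> has no effect: near a zero of \<open>f'\<close> (which
  is not at the origin, as \<open>f'(0) = 1\<close>) the quotient is unbounded.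

  The principal branch \<^const>\<open>csqrt\<close> is the branch meant: \<open>1 + tanh z\<close> avoids the cut
  on the disk, so the composition is holomorphic there, with value 1 at 0
  (lemmas \<open>holomorphic_csqrt_tanh\<close> and \<open>csqrt_tanh_0\<close>).\<close>

definition class_CB :: "(complex \<Rightarrow> complex) set" where
  "class_CB = {f \<in> class_A.
     (\<lambda>z. 1 + z * (deriv ^^ 2) f z / deriv f z) \<prec>\<^sub>s (\<lambda>z. csqrt (1 + tanh z))}"

text \<open>Matrix indices start at 0, so the entry \<open>a\<^bsub>n+i+j-2\<^esub>\<close> for \<open>1 \<le> i, j \<le> q\<close> becomes
  \<open>a\<^bsub>n+i+j\<^esub>\<close> for \<open>0 \<le> i, j < q\<close>. The qualified name selects the determinant of matrices
  whose size is a natural number.\<close>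

definition hankel :: "(complex \<Rightarrow> complex) \<Rightarrow> nat \<Rightarrow> nat \<Rightarrow> complex" where
  "hankel f q n = Determinant.det (Matrix.mat q q (\<lambda>(i, j). taylor_coeff f (n + i + j)))"

lemma holomorphic_csqrt_tanh: "(\<lambda>z. csqrt (1 + tanh z)) holomorphic_on unit_disk"
proof -
  have *: "cosh z \<noteq> 0 \<and> 1 + tanh z \<notin> \<real>\<^sub>\<le>\<^sub>0" if z: "z \<in> unit_disk" for z :: complex
  proof -
    have im: "\<bar>Im (2 * z)\<bar> < pi"
      using z abs_Im_le_cmod[of z] pi_gt3 by (simp add: dist_norm)
    define u where "u = exp (2 * z)"
    have u0: "u \<noteq> 0" by (simp add: u_def)
    have Lnu: "Ln u = 2 * z"
      unfolding u_def using im by (intro Ln_exp) auto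
    have u: "u \<notin> \<real>\<^sub>\<le>\<^sub>0"
    proof
      assume "u \<in> \<real>\<^sub>\<le>\<^sub>0"
      hence "Im u = 0 \<and> Re u < 0"
        using u0 by (auto simp: complex_nonpos_Reals_iff complex_eq_iff)
      hence "Im (Ln u) = pi" using u0 Im_Ln_eq_pi by blast
      with Lnu im show False by simp
    qed
    have u1: "u + 1 \<noteq> 0"
    proof
      assume "u + 1 = 0"
      hence "u = -1" by (simp add: eq_neg_iff_add_eq_0)
      with u show False by (simp add: complex_nonpos_Reals_iff)
    qed
    define e where "e = exp z"
    have e0: "e \<noteq> 0" by (simp add: e_def)
    have ez: "u = e * e" unfolding u_def e_def by (metis exp_add mult_2)
    have em: "e * exp (- z) = 1" by (simp add: e_def exp_minus_inverse)
    have "cosh z * (2 * e) = e * e + e * exp (- z)"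
      unfolding cosh_field_def e_def by (simp add: algebra_simps)
    hence c: "cosh z * (2 * e) = u + 1" by (simp only: em ez)
    have "sinh z * (2 * e) = e * e - e * exp (- z)"
      unfolding sinh_field_def e_def by (simp add: algebra_simps diff_divide_distrib)
    hence s: "sinh z * (2 * e) = u - 1" by (simp only: em ez)
    have c0: "cosh z \<noteq> 0" using u1 c by auto
    have "tanh z = (sinh z * (2 * e)) / (cosh z * (2 * e))"
      using e0 by (simp add: tanh_def)
    also have "\<dots> = (u - 1) / (u + 1)" by (simp only: c s)
    finally have t: "tanh z * (u + 1) = u - 1" using u1 by simp
    have "1 + tanh z \<notin> \<real>\<^sub>\<le>\<^sub>0"
    proof
      assume "1 + tanh z \<in> \<real>\<^sub>\<le>\<^sub>0"
      then obtain r where r: "1 + tanh z = of_real r" "r \<le> 0"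
        by (auto elim!: nonpos_Reals_cases)
      have "2 * u = of_real r * (u + 1)" 
        using t by (simp add: algebra_simps flip: r(1))
      hence eq: "u * of_real (2 - r) = of_real r" by (simp add: algebra_simps)
      have "complex_of_real (2 - r) \<noteq> 0" using r(2) by (subst of_real_eq_0_iff) simp
      hence "u = of_real r / of_real (2 - r)" using eq by (metis nonzero_mult_div_cancel_right)
      hence "u = of_real (r / (2 - r))" by simp
      moreover have "r / (2 - r) \<le> 0" using r(2) by (simp add: divide_nonpos_pos)
      ultimately show False using u by (metis nonpos_Reals_of_real_iff)
    qed
    with c0 show ?thesis by blast
  qed
  have "sinh = (\<lambda>z::complex. (exp z - exp (- z)) / 2)"
    by (simp add: fun_eq_iff sinh_field_def)
  moreover have "(\<lambda>z::complex. (exp z - exp (- z)) / 2) holomorphic_on unit_disk"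
    by (intro holomorphic_intros) auto
  ultimately have sh: "(sinh :: complex \<Rightarrow> complex) holomorphic_on unit_disk" by simp
  have "cosh = (\<lambda>z::complex. (exp z + exp (- z)) / 2)"
    by (simp add: fun_eq_iff cosh_field_def)
  moreover have "(\<lambda>z::complex. (exp z + exp (- z)) / 2) holomorphic_on unit_disk"
    by (intro holomorphic_intros) auto
  ultimately have ch: "(cosh :: complex \<Rightarrow> complex) holomorphic_on unit_disk" by simp
  show ?thesis
    unfolding tanh_def
    by (intro holomorphic_intros sh ch)
      (use * in \<open>auto simp: tanh_def\<close>)
qed

lemma csqrt_tanh_0: "csqrt (1 + tanh 0) = 1"
  by simp

lemma class_A_taylor_coeff:
  assumes "f \<in> class_A"
  shows "taylor_coeff f 0 = 0" "taylor_coeff f 1 = 1"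
    "\<And>z. z \<in> unit_disk \<Longrightarrow> (\<lambda>n. taylor_coeff f (n + 2) * z ^ (n + 2)) sums (f z - z)"
proof -
  from assms obtain a where hol: "f holomorphic_on unit_disk"
    and a: "\<And>z. z \<in> unit_disk \<Longrightarrow> (\<lambda>n. a (n + 2) * z ^ (n + 2)) sums (f z - z)"
    unfolding class_A_def by blast
  define b where "b n = (if n = 0 then 0 else if n = 1 then 1 else a n)" for n
  have b: "(\<lambda>n. b n * z ^ n) sums f z" if "z \<in> unit_disk" for z
    using iffD1[OF sums_iff_shift[of "\<lambda>n. b n * z ^ n" 2 "f z - z"]] a[OF that]
    by (simp add: b_def numeral_2_eq_2)
  have exp: "f has_fps_expansion Abs_fps b"
    unfolding has_fps_expansion_def
  proof
    have "conv_radius b \<ge> norm (1 / 2 :: complex)"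
      using b[of "1 / 2"] by (intro conv_radius_geI) (auto simp: sums_iff)
    moreover have "ereal (norm (1 / 2 :: complex)) > 0" by simp
    ultimately show "fps_conv_radius (Abs_fps b) > 0"
      unfolding fps_conv_radius_def fps_nth_Abs_fps by (metis less_le_trans)
    have "eventually (\<lambda>z. z \<in> unit_disk) (nhds 0)"
      by (intro eventually_nhds_in_open) auto
    thus "eventually (\<lambda>z. eval_fps (Abs_fps b) z = f z) (nhds 0)"
      by eventually_elim (use b in \<open>auto simp: eval_fps_def sums_iff\<close>)
  qed
  have t: "taylor_coeff f n = b n" for n
    using fps_nth_fps_expansion[OF exp, of n] by (simp add: taylor_coeff_def fps_expansion_def)
  show "taylor_coeff f 0 = 0" "taylor_coeff f 1 = 1" by (simp_all add: t b_def)
  show "(\<lambda>n. taylor_coeff f (n + 2) * z ^ (n + 2)) sums (f z - z)" if "z \<in> unit_disk" for z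
    using a[OF that] by (simp add: t b_def)
qed

lemma hankel_3_1:
  assumes "f \<in> class_A"
  defines "a \<equiv> taylor_coeff f"
  shows "hankel f 3 1 = 2 * a 2 * a 3 * a 4 - a 3 ^ 3 - a 4 ^ 2 - a 2 ^ 2 * a 5 + a 3 * a 5"
proof -
  define M where "M = Matrix.mat 3 3 (\<lambda>(i, j). a (1 + i + j))"
  have M: "M \<in> carrier_mat 3 3" by (simp add: M_def)
  have d: "Determinant.det A = A $$ (0, 0) * A $$ (1, 1) - A $$ (0, 1) * A $$ (1, 0)"
    if "A \<in> carrier_mat 2 2" for A :: "complex mat"
  proof -
    have s2: "{..<2::nat} = {0, 1}" by auto
    have "Determinant.det A = (\<Sum>j<2. A $$ (0, j) * Determinant.cofactor A 0 j)"
      by (rule laplace_expansion_row[OF that]) simp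
    also have "\<dots> = A $$ (0, 0) * Determinant.det (mat_delete A 0 0)
        - A $$ (0, 1) * Determinant.det (mat_delete A 0 1)"
      by (simp add: s2 Determinant.cofactor_def)
    also have "Determinant.det (mat_delete A 0 0) = A $$ (1, 1)"
      using that by (subst det_single) (auto simp: mat_delete_def)
    also have "Determinant.det (mat_delete A 0 1) = A $$ (1, 0)"
      using that by (subst det_single) (auto simp: mat_delete_def)
    finally show ?thesis .
  qed
  have s3: "{..<3::nat} = {0, 1, 2}" by auto
  have a1: "a 1 = 1" using class_A_taylor_coeff(2)[OF assms(1)] by (simp add: a_def)
  have "Determinant.det M = (\<Sum>j<3. M $$ (0, j) * Determinant.cofactor M 0 j)"
    by (rule laplace_expansion_row[OF M]) simp
  also have "\<dots> = 2 * a 2 * a 3 * a 4 - a 3 ^ 3 - a 4 ^ 2 - a 2 ^ 2 * a 5 + a 3 * a 5"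
    using a1
    by (simp add: s3 Determinant.cofactor_def d mat_delete_def M_def eval_nat_numeral algebra_simps)
  finally show ?thesis by (simp add: hankel_def M_def a_def)
qed

end

theory Submission
  imports Defs
begin

text \<open>Let \<open>c\<^sub>1, \<dots>, c\<^sub>4\<close> be the first Taylor coefficients of the Schwarz function of \<open>f\<close>. Comparing
  coefficients makes \<open>576 H\<^sub>3(1)\<close> a polynomial in them containing the term
  \<open>- c\<^sub>3\<^sup>2\<close>. Bessel's inequality \<open>|c\<^sub>1|\<^sup>2 + \<dots> + |c\<^sub>4|\<^sup>2 \<le> 1\<close> is enough for
  the bound: after the triangle inequality, all terms other than \<open>|c\<^sub>3|\<^sup>2\<close> are absorbed by
  \<open>|c\<^sub>1|\<^sup>2 + |c\<^sub>2|\<^sup>2 + |c\<^sub>4|\<^sup>2\<close>. The Schwarz function \<open>z\<^sup>3\<close> gives equality.\<close>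

section \<open>Taylor coefficients and Bessel's inequality on the unit disk\<close>

lemma has_fps_expansion_holomorphic_disk:
  "f holomorphic_on unit_disk \<Longrightarrow> f has_fps_expansion fps_expansion f 0"
  by (rule has_fps_expansion_fps_expansion[of unit_disk]) auto

text \<open>Carries identities between functions near 0 over to formal power series; the three
  equations assumed in \<open>fps_hankel_identity\<close> are obtained this way.\<close>

lemma has_fps_expansion_eventually_eq:
  fixes F G :: "complex fps"
  assumes "\<forall>\<^sub>F z in nhds 0. f z = g z" "f has_fps_expansion F" "g has_fps_expansion G"
  shows "F = G"
  using assms has_fps_expansion_cong[OF assms(1) refl] fps_expansion_unique_complex by blast

lemma taylor_coeff_eqI:
  "f has_fps_expansion F \<Longrightarrow> taylor_coeff f n = fps_nth F n"
  unfolding taylor_coeff_def using fps_expansion_eqI by blast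

text \<open>Cauchy's formula for the k-th derivative. The circle has derivative 2 pi i times itself,
  which cancels one of the k + 1 powers in the denominator and leaves a plain mean over
  [0, 1].\<close>

lemma taylor_coeff_circle_mean:
  assumes "f holomorphic_on unit_disk" "0 < r" "r < 1"
  shows "((\<lambda>t. f (circlepath 0 r t) / circlepath 0 r t ^ k) has_integral taylor_coeff f k) {0..1}"
proof -
  have "((\<lambda>u. f u / (u - 0) ^ Suc k) has_contour_integral
      (2 * pi * \<i>) / fact k * (deriv ^^ k) f 0) (circlepath 0 r)"
  proof (rule Cauchy_has_contour_integral_higher_derivative_circlepath)
    show "continuous_on (cball 0 r) f"
      using assms by (auto intro!: holomorphic_on_imp_continuous_on elim!: holomorphic_on_subset)
    show "f holomorphic_on ball 0 r"
      by (rule holomorphic_on_subset[OF assms(1)]) (use assms in auto)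
  qed (use assms in auto)
  moreover have "vector_derivative (circlepath 0 r) (at t) = 2 * pi * \<i> * circlepath 0 r t" for t
    unfolding vector_derivative_circlepath by (simp add: circlepath)
  ultimately have "((\<lambda>t. f (circlepath 0 r t) / circlepath 0 r t ^ Suc k *
      (2 * pi * \<i> * circlepath 0 r t)) has_integral 2 * pi * \<i> * taylor_coeff f k) {0..1}"
    by (simp add: has_contour_integral taylor_coeff_def fps_expansion_def)
  then have "((\<lambda>t. 1 / (2 * pi * \<i>) * (f (circlepath 0 r t) / circlepath 0 r t ^ Suc k *
      (2 * pi * \<i> * circlepath 0 r t))) has_integral
      1 / (2 * pi * \<i>) * (2 * pi * \<i> * taylor_coeff f k)) {0..1}"
    by (rule has_integral_mult_right)
  moreover have "circlepath 0 r t \<noteq> 0" for t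
    using assms by (simp add: circlepath)
  ultimately show ?thesis
    by (simp add: field_simps)
qed

lemma taylor_coeff_polynomial:
  "taylor_coeff (\<lambda>z. \<Sum>k\<le>n. c k * z ^ k) m = (if m \<le> n then c m else 0)"
proof -
  have "(\<lambda>z. \<Sum>k\<le>n. c k * z ^ k) has_fps_expansion (\<Sum>k\<le>n. fps_const (c k) * fps_X ^ k)"
    by (intro fps_expansion_intros)
  then show ?thesis
    by (simp add: taylor_coeff_eqI fps_sum_nth fps_X_power_nth if_distrib[of "(*) _"] cong: if_cong)
qed

text \<open>The Taylor polynomial \<open>p\<close> is the orthogonal projection of \<open>f\<close> in \<open>L\<^sup>2\<close> of the circle. On the
  circle \<open>cnj z = r\<^sup>2 / z\<close>, so Cauchy's formula evaluates all inner products with \<open>p\<close>.\<close>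

lemma bessel_circle:
  assumes f: "f holomorphic_on unit_disk" and le: "\<And>z. z \<in> unit_disk \<Longrightarrow> norm (f z) \<le> 1"
    and r: "0 < r" "r < 1"
  shows "(\<Sum>k\<le>n. (norm (taylor_coeff f k) * r ^ k)\<^sup>2) \<le> 1"
proof -
  define c where "c = taylor_coeff f"
  define p where "p z = (\<Sum>k\<le>n. c k * z ^ k)" for z
  define \<gamma> where "\<gamma> = circlepath 0 r"
  define S where "S = (\<Sum>k\<le>n. (norm (c k) * r ^ k)\<^sup>2)"
  have norm_\<gamma>: "norm (\<gamma> t) = r" for t
    using r by (simp add: \<gamma>_def circlepath norm_mult)
  have \<gamma>: "\<gamma> t \<noteq> 0" "\<gamma> t \<in> unit_disk" for t
    using r norm_\<gamma>[of t] by auto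
  have cnj_\<gamma>: "cnj (\<gamma> t) = of_real (r\<^sup>2) / \<gamma> t" for t
    using \<gamma>[of t] norm_\<gamma>[of t] complex_norm_square[of "\<gamma> t"] by (simp add: field_simps)
  have cnj_p: "cnj (p (\<gamma> t)) = (\<Sum>k\<le>n. cnj (c k) * of_real ((r ^ k)\<^sup>2) / \<gamma> t ^ k)" for t
    by (simp add: p_def cnj_\<gamma> power_divide flip: power_mult) (simp add: mult.commute)
  \<comment> \<open>Stated for every g that shares its coefficients up to n with p, so that it
    covers both f and p: each has inner product S with p.\<close>
  have integral: "((\<lambda>t. g (\<gamma> t) * cnj (p (\<gamma> t))) has_integral of_real S) {0..1}"
    if g: "g holomorphic_on unit_disk" and c: "\<And>k. k \<le> n \<Longrightarrow> taylor_coeff g k = c k" for g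
  proof -
    have "((\<lambda>t. \<Sum>k\<le>n. cnj (c k) * of_real ((r ^ k)\<^sup>2) * (g (\<gamma> t) / \<gamma> t ^ k)) has_integral
        (\<Sum>k\<le>n. cnj (c k) * of_real ((r ^ k)\<^sup>2) * taylor_coeff g k)) {0..1}"
      unfolding \<gamma>_def
      by (intro has_integral_sum has_integral_mult_right taylor_coeff_circle_mean g r) auto
    also have "(\<Sum>k\<le>n. cnj (c k) * of_real ((r ^ k)\<^sup>2) * taylor_coeff g k) = of_real S"
    proof -
      have "cnj (c k) * of_real ((r ^ k)\<^sup>2) * c k = of_real ((norm (c k) * r ^ k)\<^sup>2)" for k
        unfolding power_mult_distrib of_real_mult complex_norm_square by (simp only: mult_ac)
      then show ?thesis
        unfolding S_def of_real_sum by (intro sum.cong) (auto simp: c)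
    qed
    finally show ?thesis
      by (simp add: cnj_p sum_distrib_left mult_ac)
  qed
  have "((\<lambda>t. Re (f (\<gamma> t) * cnj (p (\<gamma> t)))) has_integral S) {0..1}"
    using has_integral_Re[OF integral[OF f]] by (simp add: c_def)
  moreover have "((\<lambda>t. Re (p (\<gamma> t) * cnj (p (\<gamma> t)))) has_integral S) {0..1}"
  proof -
    have "p holomorphic_on unit_disk"
      unfolding p_def by (intro holomorphic_intros)
    moreover have "taylor_coeff p k = c k" if "k \<le> n" for k
      using that unfolding p_def by (simp add: taylor_coeff_polynomial)
    ultimately show ?thesis
      using has_integral_Re[OF integral[of p]] by simp
  qed
  \<comment> \<open>This combination has a known integral, and pointwise it is |f|^2 - |f - p|^2,
    hence at most 1.\<close>
  ultimately have "((\<lambda>t. 2 * Re (f (\<gamma> t) * cnj (p (\<gamma> t))) - Re (p (\<gamma> t) * cnj (p (\<gamma> t))))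
      has_integral 2 * S - S) {0..1}"
    by (intro has_integral_diff has_integral_mult_right)
  moreover have "((\<lambda>t::real. 1::real) has_integral 1) {0..1}"
    using has_integral_const_real[of "1::real" 0 1] by simp
  moreover have "2 * Re (f (\<gamma> t) * cnj (p (\<gamma> t))) - Re (p (\<gamma> t) * cnj (p (\<gamma> t))) \<le> 1" for t
  proof -
    have "2 * Re (f (\<gamma> t) * cnj (p (\<gamma> t))) - Re (p (\<gamma> t) * cnj (p (\<gamma> t)))
        = (norm (f (\<gamma> t)))\<^sup>2 - (norm (f (\<gamma> t) - p (\<gamma> t)))\<^sup>2"
      unfolding cmod_power2 by (simp add: power2_eq_square algebra_simps)
    also have "\<dots> \<le> (norm (f (\<gamma> t)))\<^sup>2"
      by simp
    also have "\<dots> \<le> 1"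
      using le[OF \<gamma>(2)] by (simp add: power_le_one)
    finally show ?thesis .
  qed
  ultimately have "2 * S - S \<le> 1"
    by (rule has_integral_le)
  then show ?thesis
    by (simp add: S_def c_def)
qed

text \<open>Since f is given on the open disk, circles of radius r < 1 come first; the finite sum is
  continuous in r, so r may tend to 1 from the left.\<close>

lemma bessel_inequality:
  assumes "f holomorphic_on unit_disk" "\<And>z. z \<in> unit_disk \<Longrightarrow> norm (f z) \<le> 1"
  shows "(\<Sum>k\<le>n. (norm (taylor_coeff f k))\<^sup>2) \<le> 1"
proof -
  have "((\<lambda>r. \<Sum>k\<le>n. (norm (taylor_coeff f k) * r ^ k)\<^sup>2) \<longlongrightarrow>
      (\<Sum>k\<le>n. (norm (taylor_coeff f k) * 1 ^ k)\<^sup>2)) (at_left 1)"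
    by (intro tendsto_intros)
  moreover have "\<forall>\<^sub>F r in at_left (1 :: real). r \<in> {0<..<1}"
    by (rule eventually_at_left_real) simp
  then have "\<forall>\<^sub>F r in at_left 1. (\<Sum>k\<le>n. (norm (taylor_coeff f k) * r ^ k)\<^sup>2) \<le> 1"
    by eventually_elim (use bessel_circle[OF assms] in auto)
  ultimately have "(\<Sum>k\<le>n. (norm (taylor_coeff f k) * 1 ^ k)\<^sup>2) \<le> 1"
    by (intro tendsto_upperbound) auto
  then show ?thesis
    by simp
qed

section \<open>A real inequality on the unit ball for the absolute values of the
  coefficients\<close>

text \<open>Here a, b, d, e stand for |c_1|, |c_2|, |c_3|, |c_4|, and the left side is what the
  triangle inequality makes of the polynomial in \<open>fps_hankel_identity\<close>. Completing
  squares in e and in a * d leaves an inequality in A = a^2 and b alone, with A + b^2 as the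
  available budget.\<close>

lemma hankel_majorant_le_1:
  fixes a b d e :: real
  assumes nonneg: "0 \<le> a" "0 \<le> b" "0 \<le> d" "0 \<le> e" and sphere: "a\<^sup>2 + b\<^sup>2 + d\<^sup>2 + e\<^sup>2 \<le> 1"
  shows "d\<^sup>2 + 6/5 * b * e + 1/3 * b^3 + 7/10 * a * b * d + 3/5 * a\<^sup>2 * e + 17/16 * a\<^sup>2 * b\<^sup>2
    + 83/120 * a^3 * d + 131/480 * a^4 * b + 1157/11520 * a^6 \<le> 1"
proof -
  define A where "A = a\<^sup>2"
  have A: "0 \<le> A" "A + b\<^sup>2 + d\<^sup>2 + e\<^sup>2 \<le> 1"
    using sphere by (auto simp: A_def)
  then have A1: "A \<le> 1" and bA: "b\<^sup>2 \<le> 1 - A" and dA: "d\<^sup>2 \<le> 1 - A - b\<^sup>2"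
    using zero_le_power2[of b] zero_le_power2[of d] zero_le_power2[of e] by linarith+
  have e: "6/5 * b * e + 3/5 * A * e \<le> e\<^sup>2 + (3/5 * b + 3/10 * A)\<^sup>2"
    using zero_le_power2[of "e - (3/5 * b + 3/10 * A)"]
    by (simp add: power2_eq_square algebra_simps)
  \<comment> \<open>The term d^2 of the claim already uses up the d^2 of the sphere. So the square
    is completed in a * d, and A * d^2 is traded through the sphere for A * (1 - A - b^2), whose
    leading A cancels against the budget.\<close>
  have "2 * (a * d) * (7/20 * b + 83/240 * A) \<le> (a * d)\<^sup>2 + (7/20 * b + 83/240 * A)\<^sup>2"
    by (rule sum_squares_bound)
  moreover have "(a * d)\<^sup>2 \<le> A * (1 - A - b\<^sup>2)"
    using mult_left_mono[OF dA A(1)] by (simp add: A_def power_mult_distrib)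
  ultimately have d: "7/10 * a * b * d + 83/120 * a^3 * d
      \<le> A * (1 - A - b\<^sup>2) + (7/20 * b + 83/240 * A)\<^sup>2"
    by (simp add: A_def power2_eq_square power3_eq_cube algebra_simps)
  \<comment> \<open>The tangent bound sqrt (1 - A) \<le> 1 - A / 2 turns the cubic term into
    multiples of b^2 and A * b^2.\<close>
  have "1 - A \<le> (1 - A / 2)\<^sup>2"
    by (simp add: power2_eq_square algebra_simps)
  with bA have "b\<^sup>2 \<le> (1 - A / 2)\<^sup>2"
    by simp
  then have "b \<le> 1 - A / 2"
    by (rule power2_le_imp_le) (use A1 in simp)
  then have "b\<^sup>2 * b \<le> b\<^sup>2 * (1 - A / 2)"
    by (rule mult_left_mono) simp
  then have b: "b^3 \<le> b\<^sup>2 - A * b\<^sup>2 / 2"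
    by (simp only: power3_eq_cube power2_eq_square right_diff_distrib mult_1_right times_divide_eq_right mult_ac)
  have S: "A * (b - 131/100 * A)\<^sup>2 = A * b\<^sup>2 - 131/50 * (A\<^sup>2 * b) + 17161/10000 * A^3"
    and T: "(b - 327/200 * A)\<^sup>2 = b\<^sup>2 - 327/100 * (A * b) + 106929/40000 * A\<^sup>2"
    and U: "(3/5 * b + 3/10 * A)\<^sup>2 = 36/100 * b\<^sup>2 + 36/100 * (A * b) + 9/100 * A\<^sup>2"
    and V: "(7/20 * b + 83/240 * A)\<^sup>2 = 49/400 * b\<^sup>2 + 581/2400 * (A * b) + 6889/57600 * A\<^sup>2"
    and W: "A * (1 - A - b\<^sup>2) = A - A\<^sup>2 - A * b\<^sup>2"
    by (simp_all add: power2_eq_square power3_eq_cube algebra_simps)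
  \<comment> \<open>The numbers 131/100 and 327/200 complete the squares up to rounding.\<close>
  have "131/50 * (A\<^sup>2 * b) \<le> A * b\<^sup>2 + 17161/10000 * A^3"
    using mult_nonneg_nonneg[OF A(1) zero_le_power2[of "b - 131/100 * A"]] unfolding S by linarith
  moreover have "327/100 * (A * b) \<le> b\<^sup>2 + 106929/40000 * A\<^sup>2"
    using zero_le_power2[of "b - 327/200 * A"] unfolding T by linarith
  moreover have "A^3 \<le> A\<^sup>2" "0 \<le> A\<^sup>2"
    using A A1 by (auto intro: power_decreasing)
  \<comment> \<open>The rounded square yields slightly more A * b than is wanted; its sign lets the
    surplus be dropped.\<close>
  moreover have "0 \<le> A * b" using A nonneg by auto
  \<comment> \<open>The coefficients 5/48 and 221/1200 are exactly what remains of A * b^2 and b^2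
    after the estimates above. Of A^2 there remains 1 - 9/100 - 6889/57600 > 0.79, enough for 0.2792
    + 1/2.\<close>
  ultimately have poly: "131/480 * (A\<^sup>2 * b) + 1157/11520 * A^3 \<le> 5/48 * (A * b\<^sup>2) + 2792/10000 * A\<^sup>2"
    "1445/2400 * (A * b) \<le> 221/1200 * b\<^sup>2 + 1/2 * A\<^sup>2"
    by linarith+
  have "a^4 * b = A\<^sup>2 * b" "a^6 = A^3"
    by (simp_all add: A_def flip: power_mult)
  then show ?thesis
    using e d b poly A(2) zero_le_power2[of A] unfolding A_def[symmetric] U V W mult.assoc by linarith
qed

section \<open>The Hankel determinant as a polynomial in the Schwarz coefficients\<close>

lemma fps_mult_nth_upto_4:
  fixes F G :: "'a::comm_semiring_1 fps"
  shows "fps_nth (F * G) 1 = fps_nth F 0 * fps_nth G 1 + fps_nth F 1 * fps_nth G 0"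
    "fps_nth (F * G) 2 = fps_nth F 0 * fps_nth G 2 + fps_nth F 1 * fps_nth G 1 + fps_nth F 2 * fps_nth G 0"
    "fps_nth (F * G) 3 = fps_nth F 0 * fps_nth G 3 + fps_nth F 1 * fps_nth G 2 + fps_nth F 2 * fps_nth G 1
      + fps_nth F 3 * fps_nth G 0"
    "fps_nth (F * G) 4 = fps_nth F 0 * fps_nth G 4 + fps_nth F 1 * fps_nth G 3 + fps_nth F 2 * fps_nth G 2
      + fps_nth F 3 * fps_nth G 1 + fps_nth F 4 * fps_nth G 0"
  by (simp_all add: fps_mult_nth eval_nat_numeral)

text \<open>\<open>Ws\<close>, \<open>Es\<close>, \<open>Hs\<close>, \<open>Fs\<close> stand for the Schwarz function \<open>w\<close>, \<open>exp (2 w)\<close>,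
  \<open>sqrt (1 + tanh w)\<close> and \<open>f\<close>. Since \<open>1 + tanh w = 2 exp (2 w) / (exp (2 w) + 1)\<close>, the three
  equations determine the coefficients recursively.\<close>

lemma fps_hankel_identity:
  fixes Ws Es Hs Fs :: "complex fps"
  defines "c \<equiv> fps_nth Ws" and "E \<equiv> fps_nth Es" and "H \<equiv> fps_nth Hs" and "F \<equiv> fps_nth Fs"
  assumes E_deriv: "fps_deriv Es = 2 * (fps_deriv Ws * Es)" and H_sq: "Hs\<^sup>2 * (Es + 1) = 2 * Es"
    and ODE: "fps_X * fps_deriv (fps_deriv Fs) = (Hs - 1) * fps_deriv Fs"
    and E0: "E 0 = 1" and H0: "H 0 = 1" and F1: "F 1 = 1"
  shows "576 * (2 * F 2 * F 3 * F 4 - F 3^3 - (F 4)\<^sup>2 - (F 2)\<^sup>2 * F 5 + F 3 * F 5) =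
    - (c 3)\<^sup>2 + 6/5 * c 2 * c 4 - 1/3 * c 2^3 + 7/10 * c 1 * c 2 * c 3
    - 3/5 * (c 1)\<^sup>2 * c 4 - 17/16 * (c 1)\<^sup>2 * (c 2)\<^sup>2 + 83/120 * c 1^3 * c 3
    + 131/480 * c 1^4 * c 2 - 1157/11520 * c 1^6"
proof -
  note nth = fps_mult_nth_upto_4 fps_mult_nth_0 fps_numeral_nth fps_X_mult_nth
    E0[unfolded E_def] H0[unfolded H_def] F1[unfolded F_def]
  have "fps_nth (fps_deriv Ws * Es) 0 = c 1"
    "fps_nth (fps_deriv Ws * Es) 1 = c 1 * E 1 + 2 * c 2"
    "fps_nth (fps_deriv Ws * Es) 2 = c 1 * E 2 + 2 * c 2 * E 1 + 3 * c 3"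
    "fps_nth (fps_deriv Ws * Es) 3 = c 1 * E 3 + 2 * c 2 * E 2 + 3 * c 3 * E 1 + 4 * c 4"
    by (simp_all add: nth c_def E_def del: One_nat_def)
  note nth_E = this
  have E1: "E 1 = 2 * c 1"
    using arg_cong[OF E_deriv, of "\<lambda>F. fps_nth F 0"]
    by (simp add: nth E_def c_def del: One_nat_def)
  have "2 * E 2 = 2 * (c 1 * E 1 + 2 * c 2)"
    using arg_cong[OF E_deriv, of "\<lambda>F. fps_nth F 1"]
    by (simp add: fps_mult_nth_upto_4[of 2] nth_E fps_numeral_nth E_def del: One_nat_def)
  then have E2: "E 2 = c 1 * E 1 + 2 * c 2"
    by (metis mult_cancel_left zero_neq_numeral)
  have "3 * E 3 = 2 * (c 1 * E 2 + 2 * c 2 * E 1 + 3 * c 3)"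
    using arg_cong[OF E_deriv, of "\<lambda>F. fps_nth F 2"]
    by (simp add: fps_mult_nth_upto_4[of 2] nth_E fps_numeral_nth E_def del: One_nat_def)
  then have E3: "E 3 = 2/3 * (c 1 * E 2 + 2 * c 2 * E 1 + 3 * c 3)"
    by (simp add: field_simps)
  have "4 * E 4 = 2 * (c 1 * E 3 + 2 * c 2 * E 2 + 3 * c 3 * E 1 + 4 * c 4)"
    using arg_cong[OF E_deriv, of "\<lambda>F. fps_nth F 3"]
    by (simp add: fps_mult_nth_upto_4[of 2] nth_E fps_numeral_nth E_def del: One_nat_def)
  then have E4: "E 4 = 1/4 * (2 * (c 1 * E 3 + 2 * c 2 * E 2 + 3 * c 3 * E 1 + 4 * c 4))"
    by (simp add: field_simps)

  have sq: "fps_nth (Hs\<^sup>2) 0 = 1" "fps_nth (Hs\<^sup>2) 1 = 2 * H 1" "fps_nth (Hs\<^sup>2) 2 = 2 * H 2 + (H 1)\<^sup>2"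
    "fps_nth (Hs\<^sup>2) 3 = 2 * H 3 + 2 * H 1 * H 2"
    "fps_nth (Hs\<^sup>2) 4 = 2 * H 4 + 2 * H 1 * H 3 + (H 2)\<^sup>2"
    by (simp_all add: nth power2_eq_square H_def del: One_nat_def)
  note nth_H = fps_mult_nth_upto_4[of "Hs\<^sup>2"] fps_mult_nth_upto_4[of 2] sq fps_numeral_nth fps_one_nth E0
  \<comment> \<open>In order n, the constant term 2 of Es + 1 meets the summand 2 * H n of the
    square, so H n occurs with factor 4 and can be solved for.\<close>
  have "E 1 + 2 * H 1 * 2 = 2 * E 1"
    using arg_cong[OF H_sq, of "\<lambda>F. fps_nth F 1"]
    by (simp add: nth_H flip: E_def del: One_nat_def)
  then have H1: "H 1 = 1/4 * E 1"
    by (simp add: field_simps del: One_nat_def)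
  have "E 2 + 2 * H 1 * E 1 + (2 * H 2 + (H 1)\<^sup>2) * 2 = 2 * E 2"
    using arg_cong[OF H_sq, of "\<lambda>F. fps_nth F 2"]
    by (simp add: nth_H flip: E_def del: One_nat_def)
  then have H2: "H 2 = 1/4 * (E 2 - 2 * H 1 * E 1 - 2 * (H 1)\<^sup>2)"
    by (simp add: field_simps del: One_nat_def)
  have "E 3 + 2 * H 1 * E 2 + (2 * H 2 + (H 1)\<^sup>2) * E 1 + (2 * H 3 + 2 * H 1 * H 2) * 2 = 2 * E 3"
    using arg_cong[OF H_sq, of "\<lambda>F. fps_nth F 3"]
    by (simp add: nth_H flip: E_def del: One_nat_def)
  then have H3: "H 3 = 1/4 * (E 3 - 2 * H 1 * E 2 - (2 * H 2 + (H 1)\<^sup>2) * E 1 - 4 * H 1 * H 2)"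
    by (simp add: field_simps del: One_nat_def)
  have "E 4 + 2 * H 1 * E 3 + (2 * H 2 + (H 1)\<^sup>2) * E 2 + (2 * H 3 + 2 * H 1 * H 2) * E 1
      + (2 * H 4 + 2 * H 1 * H 3 + (H 2)\<^sup>2) * 2 = 2 * E 4"
    using arg_cong[OF H_sq, of "\<lambda>F. fps_nth F 4"]
    by (simp add: nth_H flip: E_def del: One_nat_def)
  then have H4: "H 4 = 1/4 * (E 4 - 2 * H 1 * E 3 - (2 * H 2 + (H 1)\<^sup>2) * E 2
      - (2 * H 3 + 2 * H 1 * H 2) * E 1 - 4 * H 1 * H 3 - 2 * (H 2)\<^sup>2)"
    by (simp add: field_simps del: One_nat_def)

  \<comment> \<open>Coefficient n on the left is n * (n + 1) * F (n + 1), whereas Hs - 1 has no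
    constant term, so the right side involves F only up to index n.\<close>
  have "2 * F 2 = H 1" "6 * F 3 = 2 * H 1 * F 2 + H 2"
    "12 * F 4 = 3 * H 1 * F 3 + 2 * H 2 * F 2 + H 3"
    "20 * F 5 = 4 * H 1 * F 4 + 3 * H 2 * F 3 + 2 * H 3 * F 2 + H 4"
    using arg_cong[OF ODE, of "\<lambda>F. fps_nth F 1"] arg_cong[OF ODE, of "\<lambda>F. fps_nth F 2"]
      arg_cong[OF ODE, of "\<lambda>F. fps_nth F 3"] arg_cong[OF ODE, of "\<lambda>F. fps_nth F 4"]
    by (simp_all add: nth H_def F_def mult_ac del: One_nat_def)
  then have F: "F 2 = 1/2 * H 1" "F 3 = 1/6 * (2 * H 1 * F 2 + H 2)"
    "F 4 = 1/12 * (3 * H 1 * F 3 + 2 * H 2 * F 2 + H 3)"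
    "F 5 = 1/20 * (4 * H 1 * F 4 + 3 * H 2 * F 3 + 2 * H 3 * F 2 + H 4)"
    by (simp_all add: field_simps del: One_nat_def)

  have E2': "E 2 = 2 * c 2 + 2 * (c 1)\<^sup>2"
    unfolding E2 E1 by (simp add: power2_eq_square)
  have E3': "E 3 = 2 * c 3 + 4 * c 1 * c 2 + 4/3 * c 1^3"
    unfolding E3 E2' E1 by Groebner_Basis.algebra
  have E4': "E 4 = 2 * c 4 + 4 * c 1 * c 3 + 2 * (c 2)\<^sup>2 + 4 * (c 1)\<^sup>2 * c 2 + 2/3 * c 1^4"
    unfolding E4 E3' E2' E1 by Groebner_Basis.algebra
  \<comment> \<open>The pure powers of c 1 in H 1 to H 4 carry the Taylor coefficients 1/2, -1/8,
    -5/48, 17/384 of sqrt (1 + tanh z), which is the case w = z.\<close>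
  have H1': "H 1 = 1/2 * c 1"
    unfolding H1 E1 by Groebner_Basis.algebra
  have H2': "H 2 = 1/2 * c 2 - 1/8 * (c 1)\<^sup>2"
    unfolding H2 H1' E2' E1 by Groebner_Basis.algebra
  have H3': "H 3 = 1/2 * c 3 - 1/4 * c 1 * c 2 - 5/48 * c 1^3"
    unfolding H3 H2' H1' E3' E2' E1 by Groebner_Basis.algebra
  have H4': "H 4 = 1/2 * c 4 - 1/8 * (c 2)\<^sup>2 - 1/4 * c 1 * c 3 - 5/16 * (c 1)\<^sup>2 * c 2 + 17/384 * c 1^4"
    unfolding H4 H3' H2' H1' E4' E3' E2' E1 by Groebner_Basis.algebra
  have F2: "F 2 = 1/4 * c 1"
    unfolding F(1) H1' by Groebner_Basis.algebra
  have F3: "F 3 = 1/12 * c 2 + 1/48 * (c 1)\<^sup>2"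
    unfolding F(2) F2 H2' H1' by Groebner_Basis.algebra
  have F4: "F 4 = 1/24 * c 3 + 1/96 * c 1 * c 2 - 13/1152 * c 1^3"
    unfolding F(3) F2 F3 H3' H2' H1' by Groebner_Basis.algebra
  have F5: "F 5 = 1/40 * c 4 + 1/240 * c 1 * c 3 - 1/48 * (c 1)\<^sup>2 * c 2 - 11/5760 * c 1^4"
    unfolding F(4) F2 F3 F4 H4' H3' H2' H1' by Groebner_Basis.algebra
  \<comment> \<open>The square of c 3 arises only from -(F 4)^2, where c 3 has coefficient 1/24;
    this is the source of 576 = 24^2.\<close>
  show ?thesis
    unfolding F2 F3 F4 F5 by Groebner_Basis.algebra
qed

section \<open>From the functions to their power series at the origin\<close>

lemma holomorphic_csqrt_tanh_schwarz:
  assumes "schwarz_function w"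
  shows "(\<lambda>z. csqrt (1 + tanh (w z))) holomorphic_on unit_disk"
proof -
  have w: "w holomorphic_on unit_disk" "\<And>z. z \<in> unit_disk \<Longrightarrow> norm (w z) \<le> norm z"
    using assms by (auto simp: schwarz_function_def)
  have "w z \<in> unit_disk" if "z \<in> unit_disk" for z
    using w(2)[OF that] that by simp
  then show ?thesis
    using holomorphic_on_compose_gen[OF w(1) holomorphic_csqrt_tanh image_subsetI]
    by (simp add: o_def)
qed

text \<open>A division-free form of 1 + tanh u = 2 exp (2 u) / (exp (2 u) + 1). The hypothesis says
  that cosh u is not 0; where it fails, the left side is 0 and the right side is -2.\<close>

lemma csqrt_tanh_exp:
  assumes "exp (2 * u) \<noteq> (-1 :: complex)"
  shows "(csqrt (1 + tanh u))\<^sup>2 * (exp (2 * u) + 1) = 2 * exp (2 * u)"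
proof -
  define x where "x = exp u"
  have x0: "x \<noteq> 0"
    by (simp add: x_def)
  have x: "exp (2 * u) = x * x"
    unfolding x_def mult_2 by (rule exp_add)
  have sum: "x * x + 1 = (x + inverse x) * x"
    using x0 by (simp add: distrib_right)
  moreover have "x * x + 1 \<noteq> 0"
    using assms unfolding x by (metis add_eq_0_iff2)
  ultimately have "x + inverse x \<noteq> 0"
    by (metis mult_zero_left)
  then have "(1 + (x - inverse x) / (x + inverse x)) * (x + inverse x) = 2 * x"
    by (simp add: distrib_right)
  moreover have "(csqrt (1 + tanh u))\<^sup>2 = 1 + (x - inverse x) / (x + inverse x)"
    by (simp add: tanh_altdef x_def exp_minus)
  ultimately show ?thesis
    unfolding x sum by (simp add: mult.assoc[symmetric])
qed

lemma hankel_schwarz_coeff: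
  assumes f: "f \<in> class_A" and w: "schwarz_function w"
    and eq: "\<forall>z\<in>unit_disk. 1 + z * (deriv ^^ 2) f z / deriv f z = csqrt (1 + tanh (w z))"
  defines "c \<equiv> taylor_coeff w"
  shows "576 * hankel f 3 1 = - (c 3)\<^sup>2 + 6/5 * c 2 * c 4 - 1/3 * c 2^3 + 7/10 * c 1 * c 2 * c 3
    - 3/5 * (c 1)\<^sup>2 * c 4 - 17/16 * (c 1)\<^sup>2 * (c 2)\<^sup>2 + 83/120 * c 1^3 * c 3
    + 131/480 * c 1^4 * c 2 - 1157/11520 * c 1^6"
proof -
  define H where "H z = csqrt (1 + tanh (w z))" for z
  define E where "E z = exp (2 * w z)" for z
  have disk: "\<forall>\<^sub>F z in nhds 0. z \<in> unit_disk"
    by (intro eventually_nhds_in_open) auto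
  have holo_f: "f holomorphic_on unit_disk"
    using f by (simp add: class_A_def)
  have w_holo: "w holomorphic_on unit_disk" and w_0: "w 0 = 0"
    using w by (auto simp: schwarz_function_def)
  have "H holomorphic_on unit_disk"
    unfolding H_def by (rule holomorphic_csqrt_tanh_schwarz[OF w])
  then obtain Hs where Hs: "H has_fps_expansion Hs"
    using has_fps_expansion_holomorphic_disk by blast
  obtain Ws where Ws: "w has_fps_expansion Ws"
    using w_holo has_fps_expansion_holomorphic_disk by blast
  have E_holo: "E holomorphic_on unit_disk"
    unfolding E_def by (intro holomorphic_intros w_holo)
  then obtain Es where Es: "E has_fps_expansion Es"
    using has_fps_expansion_holomorphic_disk by blast
  obtain Fs where Fs: "f has_fps_expansion Fs"
    using holo_f has_fps_expansion_holomorphic_disk by blast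
  have a: "taylor_coeff f n = fps_nth Fs n" for n
    by (rule taylor_coeff_eqI[OF Fs])
  have c: "c n = fps_nth Ws n" for n
    unfolding c_def by (rule taylor_coeff_eqI[OF Ws])

  \<comment> \<open>By continuity and f'(0) = 1; this allows the quotient in \<open>eq\<close> to be
    cleared near 0.\<close>
  have "\<forall>\<^sub>F z in nhds 0. deriv f z \<noteq> 0"
  proof -
    have "deriv f 0 = 1"
      using class_A_taylor_coeff(2)[OF f] by (simp add: taylor_coeff_def fps_expansion_def)
    moreover have "isCont (deriv f) 0"
      using has_fps_expansion_imp_continuous[OF has_fps_expansion_deriv[OF Fs]] .
    ultimately show ?thesis
      unfolding isCont_def tendsto_at_iff_tendsto_nhds
      by (intro tendsto_imp_eventually_ne[of _ 1]) auto
  qed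
  with disk have "\<forall>\<^sub>F z in nhds 0. z * deriv (deriv f) z = (H z - 1) * deriv f z"
  proof eventually_elim
    case (elim z)
    with bspec[OF eq elim(1)] show ?case by (simp add: H_def numeral_2_eq_2 field_simps)
  qed
  moreover have "(\<lambda>z. z * deriv (deriv f) z) has_fps_expansion fps_X * fps_deriv (fps_deriv Fs)"
    "(\<lambda>z. (H z - 1) * deriv f z) has_fps_expansion (Hs - 1) * fps_deriv Fs"
    by (intro fps_expansion_intros Hs Fs)+
  ultimately have ODE: "fps_X * fps_deriv (fps_deriv Fs) = (Hs - 1) * fps_deriv Fs"
    by (rule has_fps_expansion_eventually_eq)

  have "\<forall>\<^sub>F z in nhds 0. deriv E z = 2 * (deriv w z * E z)"
    using disk
  proof eventually_elim
    case (elim z)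
    then have "(w has_field_derivative deriv w z) (at z)"
      using w_holo by (intro holomorphic_derivI) auto
    then have "(E has_field_derivative 2 * (deriv w z * E z)) (at z)"
      unfolding E_def by (auto intro!: derivative_eq_intros)
    then show ?case by (rule DERIV_imp_deriv)
  qed
  moreover have "deriv E has_fps_expansion fps_deriv Es"
    "(\<lambda>z. 2 * (deriv w z * E z)) has_fps_expansion 2 * (fps_deriv Ws * Es)"
    by (intro fps_expansion_intros Es Ws)+
  ultimately have E_deriv: "fps_deriv Es = 2 * (fps_deriv Ws * Es)"
    by (rule has_fps_expansion_eventually_eq)

  \<comment> \<open>E is continuous with E 0 = 1, so \<open>csqrt_tanh_exp\<close> applies near
    0.\<close>
  have "\<forall>\<^sub>F z in nhds 0. E z \<noteq> -1"
    using has_fps_expansion_imp_continuous[OF Es, of UNIV] unfolding isCont_def tendsto_at_iff_tendsto_nhds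
    by (intro tendsto_imp_eventually_ne[of _ 1]) (simp_all add: E_def[of 0] w_0)
  then have "\<forall>\<^sub>F z in nhds 0. (H z)\<^sup>2 * (E z + 1) = 2 * E z"
  proof eventually_elim
    case (elim z)
    then show ?case
      unfolding H_def E_def by (rule csqrt_tanh_exp)
  qed
  moreover have "(\<lambda>z. (H z)\<^sup>2 * (E z + 1)) has_fps_expansion Hs\<^sup>2 * (Es + 1)"
    "(\<lambda>z. 2 * E z) has_fps_expansion 2 * Es"
    by (intro fps_expansion_intros Es Hs)+
  ultimately have H_sq: "Hs\<^sup>2 * (Es + 1) = 2 * Es"
    by (rule has_fps_expansion_eventually_eq)

  have E0: "fps_nth Es 0 = 1"
    using has_fps_expansion_imp_0_eq_fps_nth_0[OF Es] w_0 by (simp add: E_def)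
  have H0: "fps_nth Hs 0 = 1"
    using has_fps_expansion_imp_0_eq_fps_nth_0[OF Hs] w_0 by (simp add: H_def)
  have F1: "fps_nth Fs 1 = 1"
    using class_A_taylor_coeff(2)[OF f] by (simp add: a)
  show ?thesis
    unfolding hankel_3_1[OF f] a c
    by (rule fps_hankel_identity[OF E_deriv H_sq ODE E0 H0 F1])
qed

section \<open>Existence of a function with prescribed convexity quotient\<close>

text \<open>The equation reads f'' / f' = (p - 1) / z, whose right side k has a removable
  singularity at 0. Hence f' is the exponential of a primitive of k, and f a primitive of that; both
  exist because the disk is convex. Subtracting the values at 0 gives f'(0) = 1 and f(0) =
  0.\<close>

lemma exists_class_A_convexity_quotient:
  assumes p: "p holomorphic_on unit_disk" and p_0: "p 0 = 1"
  shows "\<exists>f\<in>class_A. \<forall>z\<in>unit_disk. 1 + z * (deriv ^^ 2) f z / deriv f z = p z"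
proof -
  define k where "k z = (if z = 0 then deriv p 0 else (p z - p 0) / (z - 0))" for z
  have "k holomorphic_on unit_disk"
    unfolding k_def by (rule pole_lemma_open[OF p]) simp
  then obtain K where K: "\<And>z. z \<in> unit_disk \<Longrightarrow> (K has_field_derivative k z) (at z)"
    using holomorphic_convex_primitive'[of unit_disk k] by (metis at_within_open convex_ball open_ball)
  define g where "g z = exp (K z - K 0)" for z
  have g: "(g has_field_derivative g z * k z) (at z)" if "z \<in> unit_disk" for z
    unfolding g_def by (auto intro!: derivative_eq_intros K that)
  then have "g holomorphic_on unit_disk"
    by (meson holomorphic_onI field_differentiable_at_within field_differentiable_def)
  then obtain F where F: "\<And>z. z \<in> unit_disk \<Longrightarrow> (F has_field_derivative g z) (at z)"
    using holomorphic_convex_primitive'[of unit_disk g] by (metis at_within_open convex_ball open_ball)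
  define f where "f z = F z - F 0" for z
  have f: "(f has_field_derivative g z) (at z)" if "z \<in> unit_disk" for z
    unfolding f_def by (auto intro!: derivative_eq_intros F that)
  then have f_holo: "f holomorphic_on unit_disk"
    by (meson holomorphic_onI field_differentiable_at_within field_differentiable_def)
  have deriv_f: "deriv f z = g z" if "z \<in> unit_disk" for z
    using f[OF that] by (rule DERIV_imp_deriv)
  have "(deriv f has_field_derivative g z * k z) (at z)" if "z \<in> unit_disk" for z
    by (rule has_field_derivative_transform_within_open[OF g[OF that], of unit_disk])
       (use that deriv_f in auto)
  then have deriv2_f: "(deriv ^^ 2) f z = g z * k z" if "z \<in> unit_disk" for z
    using that by (simp add: numeral_2_eq_2 DERIV_imp_deriv)
  have "1 + z * (deriv ^^ 2) f z / deriv f z = p z" if "z \<in> unit_disk" for z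
    using that p_0 by (simp add: deriv_f deriv2_f g_def k_def)
  moreover have "f \<in> class_A"
  proof -
    define b where "b n = (deriv ^^ n) f 0 / fact n" for n
    have "b 0 = 0" "b 1 = 1"
      by (simp_all add: b_def f_def[of 0] deriv_f g_def[of 0])
    then have "(\<lambda>n. b (n + 2) * z ^ (n + 2)) sums (f z - z)" if "z \<in> unit_disk" for z
      using holomorphic_power_series[OF f_holo that]
        sums_iff_shift[of "\<lambda>n. b n * z ^ n" 2 "f z - z"]
      by (simp add: b_def numeral_2_eq_2)
    then show ?thesis
      using f_holo unfolding class_A_def by (intro CollectI conjI exI[of _ b] ballI)
  qed
  ultimately show ?thesis
    by blast
qed

text \<open>From right to left, the holomorphy asked for by \<open>subordinate\<close> is recovered
  from the equation: on the disk the quotient agrees with the holomorphic composition of csqrt (1 +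
  tanh) and w.\<close>

lemma class_CB_iff:
  "f \<in> class_CB \<longleftrightarrow> f \<in> class_A \<and> (\<exists>w. schwarz_function w \<and>
    (\<forall>z\<in>unit_disk. 1 + z * (deriv ^^ 2) f z / deriv f z = csqrt (1 + tanh (w z))))"
proof -
  have holo: "h holomorphic_on unit_disk"
    if "schwarz_function w" "\<forall>z\<in>unit_disk. h z = csqrt (1 + tanh (w z))" for h w
    by (rule holomorphic_transform[OF holomorphic_csqrt_tanh_schwarz[OF that(1)]]) (use that(2) in auto)
  then show ?thesis
    unfolding class_CB_def subordinate_def
    using holo[where h = "\<lambda>z. 1 + z * (deriv ^^ 2) f z / deriv f z"] holomorphic_csqrt_tanh by blast
qed

section \<open>The bound 1/576 and its sharpness\<close>

theorem theorem3p1: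
  shows "(\<forall>f\<in>class_CB. norm (hankel f 3 1) \<le> 1 / 576) \<and>
         (\<exists>f\<in>class_CB. norm (hankel f 3 1) = 1 / 576)"
proof
  show "\<forall>f\<in>class_CB. norm (hankel f 3 1) \<le> 1 / 576"
  proof
    fix f assume "f \<in> class_CB"
    then obtain w where f: "f \<in> class_A" and w: "schwarz_function w"
      and eq: "\<forall>z\<in>unit_disk. 1 + z * (deriv ^^ 2) f z / deriv f z = csqrt (1 + tanh (w z))"
      by (auto simp: class_CB_iff)
    define c where "c = taylor_coeff w"
    have "norm (w z) \<le> 1" if "z \<in> unit_disk" for z
      using w that by (force simp: schwarz_function_def)
    then have "(\<Sum>k\<le>4. (norm (c k))\<^sup>2) \<le> 1"
      unfolding c_def using w by (intro bessel_inequality) (auto simp: schwarz_function_def)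
    moreover have "c 0 = 0"
      using w by (simp add: c_def taylor_coeff_def fps_expansion_def schwarz_function_def)
    ultimately have "(norm (c 1))\<^sup>2 + (norm (c 2))\<^sup>2 + (norm (c 3))\<^sup>2 + (norm (c 4))\<^sup>2 \<le> 1"
      by (simp add: eval_nat_numeral)
    note majorant = hankel_majorant_le_1[OF norm_ge_zero norm_ge_zero norm_ge_zero norm_ge_zero this]
    have "norm (576 * hankel f 3 1) \<le> 1"
      unfolding hankel_schwarz_coeff[OF f w eq, folded c_def]
      by (rule order_trans[OF _ majorant])
         \<comment> \<open>The triangle inequality, monomial by monomial, turns every sign of the
           polynomial into a plus.\<close>
         (intro norm_triangle_le norm_triangle_le_diff add_mono; simp add: norm_mult norm_power)
    then show "norm (hankel f 3 1) \<le> 1 / 576"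
      by (simp add: norm_mult)
  qed
next
  \<comment> \<open>With c 3 = 1 and all other coefficients 0, only -(c 3)^2 survives in the
    identity.\<close>
  define w :: "complex \<Rightarrow> complex" where "w z = z ^ 3" for z
  have w: "schwarz_function w"
  proof -
    have "norm z ^ 3 \<le> norm z" if "norm z < 1" for z :: complex
      using that power_decreasing[of 1 3 "norm z"] by simp
    then show ?thesis
      by (auto simp: schwarz_function_def w_def[abs_def] norm_power intro!: holomorphic_intros)
  qed
  obtain f where f: "f \<in> class_A"
    and eq: "\<forall>z\<in>unit_disk. 1 + z * (deriv ^^ 2) f z / deriv f z = csqrt (1 + tanh (w z))"
    using exists_class_A_convexity_quotient[OF holomorphic_csqrt_tanh_schwarz[OF w]]
    by (auto simp: w_def)
  have "w has_fps_expansion fps_X ^ 3"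
    unfolding w_def by (intro fps_expansion_intros)
  then have "taylor_coeff w n = (if n = 3 then 1 else 0)" for n
    by (simp add: taylor_coeff_eqI fps_X_power_nth)
  then have "576 * hankel f 3 1 = -1"
    using hankel_schwarz_coeff[OF f w eq] by simp
  then have "hankel f 3 1 = -1 / 576"
    by (simp add: field_simps)
  then have "norm (hankel f 3 1) = 1 / 576"
    by (simp add: norm_divide)
  moreover have "f \<in> class_CB"
    using f w eq by (auto simp: class_CB_iff)
  ultimately show "\<exists>f\<in>class_CB. norm (hankel f 3 1) = 1 / 576"
    by blast
qed

end
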